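(* For any $w\in S_n$, the staircase chain $C^S(w)$ is a heavy climbing chain of $w$.
   Context: Conventions. Permutations are in one-line notation; $t_{ij}$ is the transposition of $i,j$, and $wt_{ij}$ is $w$ with the values in positions $i$ and $j$ exchanged. $w_0\in S_n$ is the longest permutation, $w_0(k)=n+1-k$. The Bruhat order is the transitive closure of $w\le wt_{ij}$ for $i<j$ with $w(i)<w(j)$; $\lessdot$ denotes its cover relation. $[n]=\{1,\ldots,n\}$. Climbing chains. A climbing chain of $w\in S_n$ is a sequence $C=(C_1,\ldots,C_m)$ of pairs (links) $C_p=(i_p,j_p)$ with $i_p<j_p$, $i_1\le\cdots\le i_m$, $wt_{i_1j_1}\cdots t_{i_mj_m}=w_0$, and $wt_{i_1j_1}\cdots t_{i_{p-1}j_{p-1}}\lessdot wt_{i_1j_1}\cdots t_{i_pj_p}$ for each $p\in[m]$. (The only climbing chain of $w_0$ is empty.) The set of minimal markings is $M(C)=\{C_p\mid i_{p-1}<i_p,\text{ or } i_{p-1}=i_p\text{ and }j_{p-1}<j_p\}$ with $i_0=0$. Codes. $\overline{\mathrm{rajcode}}(w)_i$ is the maximal number $r$ of positions in a sequence $i=\alpha_1<\cdots<\alpha_r\le n$ with $w(\alpha_1)<\cdots<w(\alpha_r)$, minus one, and $\overline{\mathrm{raj}}(w)=\sum_i\overline{\mathrm{rajcode}}(w)_i$. A climbing chain $C$ of $w$ is heavy if $\#M(C)=\overline{\mathrm{raj}}(w)$. Staircase chain. For $w\ne w_0$ let $a=\min\{k\mid w(k)\ne n+1-k\}$ and $K=\{k\mid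 k>a\text{ and }w\lessdot wt_{ak}\}$. Let $K_1$ be the set of $k\in K$ at which $\overline{\mathrm{rajcode}}(w)_k$ attains its maximum over $K$. Iteratively, for $p\ge 2$, as long as there are elements of $K$ smaller than $\min(K_{p-1})$, let $K_p$ be the set of $k\in K$ with $k<\min(K_{p-1})$ at which $\overline{\mathrm{rajcode}}(w)_k$ attains its maximum over $\{k'\in K\mid k'<\min(K_{p-1})\}$. If this results in sets $K_1,\ldots,K_q$, then $\mathrm{stair}(w)$ is the sequence of pairs $(a,k)$, $k\in K_1\cup\cdots\cup K_q$, ordered so that the second components are decreasing. $C^S(w_0)$ is empty; for $w\neq w_0$ with $\mathrm{stair}(w)=((a,b_1),\ldots,(a,b_k))$, $C^S(w)$ is the concatenation of $\mathrm{stair}(w)$ and $C^S(wt_{ab_1}\cdots t_{ab_k})$. *)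

theory Defs
  imports "HOL-Combinatorics.Permutations"
begin

text \<open>
  The symmetric group \<open>S\<^sub>n\<close> is represented by the functions \<open>w :: nat \<Rightarrow> nat\<close> with
  \<open>w permutes {1..n}\<close>. Such a function is the identity outside \<open>{1..n}\<close>, so \<open>w0\<close> has to be
  extended by the identity as well. Since \<open>(w \<circ> transpose i j) i = w j\<close>, right composition with
  \<open>transpose i j\<close> exchanges the values in positions \<open>i\<close> and \<open>j\<close>.
\<close>

definition w0 :: "nat \<Rightarrow> nat \<Rightarrow> nat" where
  "w0 n k = (if k \<in> {1..n} then n + 1 - k else k)"

definition bruhat_step :: "nat \<Rightarrow> (nat \<Rightarrow> nat) \<Rightarrow> (nat \<Rightarrow> nat) \<Rightarrow> bool" where
  "bruhat_step n u v \<longleftrightarrow> u permutes {1..n} \<and>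
     (\<exists>i\<in>{1..n}. \<exists>j\<in>{1..n}. i < j \<and> u i < u j \<and> v = u \<circ> transpose i j)"

definition bruhat_le :: "nat \<Rightarrow> (nat \<Rightarrow> nat) \<Rightarrow> (nat \<Rightarrow> nat) \<Rightarrow> bool" where
  "bruhat_le n = (bruhat_step n)\<^sup>*\<^sup>*"

definition bruhat_less :: "nat \<Rightarrow> (nat \<Rightarrow> nat) \<Rightarrow> (nat \<Rightarrow> nat) \<Rightarrow> bool" where
  "bruhat_less n u v \<longleftrightarrow> bruhat_le n u v \<and> u \<noteq> v"

definition bruhat_cover :: "nat \<Rightarrow> (nat \<Rightarrow> nat) \<Rightarrow> (nat \<Rightarrow> nat) \<Rightarrow> bool" where
  "bruhat_cover n u v \<longleftrightarrow> bruhat_less n u v \<and> \<not> (\<exists>z. bruhat_less n u z \<and> bruhat_less n z v)"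

text \<open>\<open>apply_links w [(i\<^sub>1, j\<^sub>1), \<dots>, (i\<^sub>m, j\<^sub>m)]\<close> is \<open>w t\<^bsub>i\<^sub>1j\<^sub>1\<^esub> \<cdots> t\<^bsub>i\<^sub>mj\<^sub>m\<^esub>\<close>.\<close>

definition apply_links :: "(nat \<Rightarrow> nat) \<Rightarrow> (nat \<times> nat) list \<Rightarrow> nat \<Rightarrow> nat" where
  "apply_links w C = foldl (\<lambda>u (i, j). u \<circ> transpose i j) w C"

definition climbing_chain :: "nat \<Rightarrow> (nat \<Rightarrow> nat) \<Rightarrow> (nat \<times> nat) list \<Rightarrow> bool" where
  "climbing_chain n w C \<longleftrightarrow>
     (\<forall>(i, j)\<in>set C. i \<in> {1..n} \<and> j \<in> {1..n} \<and> i < j) \<and>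
     sorted (map fst C) \<and>
     apply_links w C = w0 n \<and>
     (\<forall>p<length C. bruhat_cover n (apply_links w (take p C)) (apply_links w (take (Suc p) C)))"

text \<open>
  Prepending \<open>(0, 0)\<close> makes the links numbered from \<open>1\<close> and realises the convention \<open>i\<^sub>0 = 0\<close>;
  the value \<open>j\<^sub>0 = 0\<close> is irrelevant for chains, whose links have positive first component.
\<close>

definition minimal_markings :: "(nat \<times> nat) list \<Rightarrow> (nat \<times> nat) set" where
  "minimal_markings C = (let D = (0, 0) # C in
     {D ! p | p. p \<in> {1..length C} \<and>
        (fst (D ! (p - 1)) < fst (D ! p) \<or>
         fst (D ! (p - 1)) = fst (D ! p) \<and> snd (D ! (p - 1)) < snd (D ! p))})"

definition rajcode :: "nat \<Rightarrow> (nat \<Rightarrow> nat) \<Rightarrow> nat \<Rightarrow> nat" where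
  "rajcode n w i =
     Max {length \<alpha> | \<alpha>. \<alpha> \<noteq> [] \<and> hd \<alpha> = i \<and> set \<alpha> \<subseteq> {1..n} \<and>
            sorted_wrt (<) \<alpha> \<and> sorted_wrt (<) (map w \<alpha>)} - 1"

definition raj :: "nat \<Rightarrow> (nat \<Rightarrow> nat) \<Rightarrow> nat" where
  "raj n w = (\<Sum>i = 1..n. rajcode n w i)"

definition heavy_climbing_chain :: "nat \<Rightarrow> (nat \<Rightarrow> nat) \<Rightarrow> (nat \<times> nat) list \<Rightarrow> bool" where
  "heavy_climbing_chain n w C \<longleftrightarrow> climbing_chain n w C \<and> card (minimal_markings C) = raj n w"

definition first_defect :: "nat \<Rightarrow> (nat \<Rightarrow> nat) \<Rightarrow> nat" where
  "first_defect n w = Min {k \<in> {1..n}. w k \<noteq> n + 1 - k}"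

definition cover_positions :: "nat \<Rightarrow> (nat \<Rightarrow> nat) \<Rightarrow> nat set" where
  "cover_positions n w = (let a = first_defect n w in
     {k \<in> {1..n}. a < k \<and> bruhat_cover n w (w \<circ> transpose a k)})"

definition rajcode_maximizers :: "nat \<Rightarrow> (nat \<Rightarrow> nat) \<Rightarrow> nat set \<Rightarrow> nat set" where
  "rajcode_maximizers n w A = {k \<in> A. \<forall>k'\<in>A. rajcode n w k' \<le> rajcode n w k}"

text \<open>
  \<open>stair_block n w p\<close> is \<open>K\<^bsub>p+1\<^esub>\<close> for \<open>p < q\<close> and empty for \<open>p \<ge> q\<close>, which encodes that
  the iteration has stopped; the case distinction avoids the unspecified value \<open>Min {}\<close>.
\<close>

primrec stair_block :: "nat \<Rightarrow> (nat \<Rightarrow> nat) \<Rightarrow> nat \<Rightarrow> nat set" where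
  "stair_block n w 0 = rajcode_maximizers n w (cover_positions n w)"
| "stair_block n w (Suc p) =
     (if stair_block n w p = {} then {}
      else rajcode_maximizers n w {k \<in> cover_positions n w. k < Min (stair_block n w p)})"

definition stair :: "nat \<Rightarrow> (nat \<Rightarrow> nat) \<Rightarrow> (nat \<times> nat) list" where
  "stair n w =
     map (\<lambda>k. (first_defect n w, k)) (rev (sorted_list_of_set (\<Union>p. stair_block n w p)))"

text \<open>
  No termination proof is attached, so the recursion equation is available only as \<open>psimps\<close>, that
  is, on \<open>staircase_chain_dom\<close>; outside this domain the value is unspecified. That the domain
  contains all permutations (the recursion raises \<open>w\<close> in Bruhat order as long as \<open>w \<noteq> w0 n\<close>) has to
  be shown before anything can be deduced about \<open>staircase_chain\<close>.
\<close>

function (domintros) staircase_chain :: "nat \<Rightarrow> (nat \<Rightarrow> nat) \<Rightarrow> (nat \<times> nat) list" where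
  "staircase_chain n w =
     (if w = w0 n then []
      else stair n w @ staircase_chain n (apply_links w (stair n w)))"
  by pat_completeness auto

end

theory Submission
  imports Defs
begin

text \<open>
  Let \<open>a\<close> be the first defect of \<open>w\<close>, \<open>r\<close> its code, \<open>K\<close> the set of cover positions and \<open>S \<subseteq> K\<close> the
  second components of \<open>stair(w)\<close>. \<open>S\<close> consists of the weak left-to-right maxima of \<open>r\<close> on \<open>K\<close>. The
  values of \<open>w\<close> decrease along \<open>K\<close>, so an increasing subsequence meets \<open>S\<close> at most once, and applying
  \<open>stair(w)\<close> moves each value at a position in \<open>S\<close> to the preceding element of \<open>S\<close>, its code entry
  travelling along. The only loss is that \<open>max S\<close> receives the value \<open>w(a)\<close> with entry \<open>r(max S)\<close>
  rather than \<open>r(a) = r(max S) + 1\<close>. Hence each staircase lowers \<open>raj\<close> by exactly one, while it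
  contributes exactly one minimal marking, namely its first link. The covers are recognised by
  counting inversions.
\<close>

section \<open>Covers in the Bruhat order\<close>

definition inversions :: "nat \<Rightarrow> (nat \<Rightarrow> nat) \<Rightarrow> (nat \<times> nat) set" where
  "inversions n u = {(p, q). p \<in> {1..n} \<and> q \<in> {1..n} \<and> p < q \<and> u q < u p}"

lemma finite_inversions [simp]: "finite (inversions n u)"
  by (rule finite_subset[of _ "{1..n} \<times> {1..n}"]) (auto simp: inversions_def)

text \<open>Moves a pair of positions along with the transposition, but leaves it in place where its
  order would be reversed. This is an involution on ordered pairs, used to compare the inversions
  before and after.\<close>

definition swap_pair :: "nat \<Rightarrow> nat \<Rightarrow> nat \<times> nat \<Rightarrow> nat \<times> nat" where
  "swap_pair i j = (\<lambda>(p, q). if transpose i j p < transpose i j q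
     then (transpose i j p, transpose i j q) else (p, q))"

lemma swap_pair_involutory: "fst x < snd x \<Longrightarrow> swap_pair i j (swap_pair i j x) = x"
  by (auto simp: swap_pair_def split: prod.splits)

text \<open>A pair left in place starts with \<open>i\<close> or ends with \<open>j\<close>, and its
  other entry lies within this range; raising the value at \<open>i\<close> and lowering that at
  \<open>j\<close> keeps it inverted. The pair \<open>(i, j)\<close> is missed because it is fixed
  by the map but not inverted in \<open>u\<close>.\<close>

lemma swap_pair_inversion:
  assumes "i \<in> {1..n}" "j \<in> {1..n}" "i < j" "u i < u j" "x \<in> inversions n u"
  shows "swap_pair i j x \<in> inversions n (u \<circ> transpose i j) - {(i, j)}"
  using assms
  by (cases x) (auto simp: inversions_def swap_pair_def transpose_def split: if_splits)

lemma card_inversions_less: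
  assumes "i \<in> {1..n}" "j \<in> {1..n}" "i < j" "u i < u j"
  shows "card (inversions n u) < card (inversions n (u \<circ> transpose i j))"
proof -
  have mem: "(i, j) \<in> inversions n (u \<circ> transpose i j)"
    using assms by (auto simp: inversions_def)
  have "card (inversions n u) \<le> card (inversions n (u \<circ> transpose i j) - {(i, j)})"
  proof (rule card_inj_on_le)
    show "inj_on (swap_pair i j) (inversions n u)"
      by (rule inj_on_inverseI[where g = "swap_pair i j"])
        (auto simp: inversions_def intro!: swap_pair_involutory)
    show "swap_pair i j ` inversions n u \<subseteq> inversions n (u \<circ> transpose i j) - {(i, j)}"
      by (rule image_subsetI) (rule swap_pair_inversion[OF assms])
  qed simp
  also have "\<dots> < card (inversions n (u \<circ> transpose i j))"
    by (rule card_Diff1_less[OF finite_inversions mem])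
  finally show ?thesis .
qed

text \<open>Besides \<open>(i, j)\<close>, only pairs \<open>(i, m)\<close> and
  \<open>(m, j)\<close> with \<open>m\<close> between could become new inversions. The gap condition
  excludes this, so the injection hits everything except \<open>(i, j)\<close>.\<close>

lemma card_inversions_Suc:
  assumes ij: "i \<in> {1..n}" "j \<in> {1..n}" "i < j" "u i < u j"
    and inj: "inj u" and gap: "\<And>m. i < m \<Longrightarrow> m < j \<Longrightarrow> \<not> (u i < u m \<and> u m < u j)"
  shows "card (inversions n (u \<circ> transpose i j)) = Suc (card (inversions n u))"
proof -
  let ?v = "u \<circ> transpose i j"
  have gap': "u m < u i \<or> u j < u m" if "i < m" "m < j" for m
    using gap[OF that] that inj by (metis injD linorder_neqE_nat nat_neq_iff)
  have "swap_pair i j x \<in> inversions n u" if "x \<in> inversions n ?v - {(i, j)}" for x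
  proof (cases x)
    case (Pair p q)
    with that ij gap'[of p] gap'[of q] show ?thesis
      by (auto simp: inversions_def swap_pair_def transpose_def split: if_splits)
  qed
  moreover have "fst x < snd x" if "x \<in> inversions n u'" for x u'
    using that by (auto simp: inversions_def)
  ultimately have "bij_betw (swap_pair i j) (inversions n u) (inversions n ?v - {(i, j)})"
    by (intro bij_betw_byWitness[where f' = "swap_pair i j"] ballI image_subsetI
        swap_pair_inversion[OF ij] swap_pair_involutory) (assumption | force)+
  then have "card (inversions n u) = card (inversions n ?v - {(i, j)})"
    by (rule bij_betw_same_card)
  moreover have "(i, j) \<in> inversions n ?v"
    using ij by (auto simp: inversions_def)
  ultimately show ?thesis
    by (metis card_Suc_Diff1 finite_inversions)
qed

lemma permutes_comp_transpose:
  assumes "u permutes A" "i \<in> A" "j \<in> A"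
  shows "(u \<circ> transpose i j) permutes A"
  using assms by (meson permutes_compose permutes_swap_id)

lemma bruhat_stepI:
  assumes "u permutes {1..n}" "i \<in> {1..n}" "j \<in> {1..n}" "i < j" "u i < u j"
  shows "bruhat_step n u (u \<circ> transpose i j)"
  using assms unfolding bruhat_step_def by blast

text \<open>Provides a strictly increasing measure: it gives irreflexivity along chains and leaves
  no room between elements whose counts differ by one.\<close>

lemma bruhat_le_card: "bruhat_le n u v \<Longrightarrow> u = v \<or> card (inversions n u) < card (inversions n v)"
  unfolding bruhat_le_def
proof (induction rule: rtranclp_induct)
  case (step y z)
  then have "card (inversions n y) < card (inversions n z)"
    using card_inversions_less unfolding bruhat_step_def by blast
  with step.IH show ?case by auto
qed simp

lemma bruhat_less_card: "bruhat_less n u v \<Longrightarrow> card (inversions n u) < card (inversions n v)"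
  using bruhat_le_card unfolding bruhat_less_def by blast

lemma bruhat_step_imp_less: "bruhat_step n u v \<Longrightarrow> bruhat_less n u v"
proof -
  assume *: "bruhat_step n u v"
  then have "card (inversions n u) < card (inversions n v)"
    using card_inversions_less unfolding bruhat_step_def by blast
  with * show ?thesis
    unfolding bruhat_less_def bruhat_le_def by auto
qed

lemma bruhat_less_trans: "bruhat_less n u v \<Longrightarrow> bruhat_less n v z \<Longrightarrow> bruhat_less n u z"
  using bruhat_less_card[of n u v] bruhat_less_card[of n v z]
  unfolding bruhat_less_def bruhat_le_def by auto

text \<open>An intermediate value splits the exchange into several ascending steps; without one, the
  number of inversions grows by just one, so nothing fits in between.\<close>

lemma bruhat_cover_transpose_iff:
  assumes u: "u permutes {1..n}" and i: "i \<in> {1..n}" and j: "j \<in> {1..n}" and "i < j"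
  shows "bruhat_cover n u (u \<circ> transpose i j) \<longleftrightarrow>
    u i < u j \<and> (\<forall>m. i < m \<longrightarrow> m < j \<longrightarrow> \<not> (u i < u m \<and> u m < u j))"
    (is "?cover \<longleftrightarrow> ?less \<and> ?gap")
proof (intro iffI conjI)
  let ?v = "u \<circ> transpose i j"
  assume cover: ?cover
  then have less: "bruhat_less n u ?v"
    by (simp add: bruhat_cover_def)
  show ?less
  proof (rule ccontr)
    assume "\<not> u i < u j"
    moreover have "u i \<noteq> u j"
      using \<open>i < j\<close> permutes_inj[OF u] by (auto dest: injD)
    ultimately have "?v i < ?v j" by simp
    \<comment> \<open>Exchanging again leads back up to \<open>u\<close>, so \<open>u\<close> and
      \<open>?v\<close> would each lie below the other.\<close>
    then have "bruhat_less n ?v (?v \<circ> transpose i j)"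
      using bruhat_stepI[OF permutes_comp_transpose[OF u i j] i j \<open>i < j\<close>] bruhat_step_imp_less
      by blast
    then have "bruhat_less n ?v u" by (simp add: comp_assoc)
    from bruhat_less_card[OF this] bruhat_less_card[OF less] show False by simp
  qed
  show ?gap
  proof (intro allI impI notI)
    fix m assume m: "i < m" "m < j" "u i < u m \<and> u m < u j"
    have mn: "m \<in> {1..n}" using m i j by auto
    \<comment> \<open>The increasing values in positions \<open>i\<close>, \<open>m\<close>,
      \<open>j\<close> are reversed by three ascending exchanges, whose product is
      \<open>transpose i j\<close>.\<close>
    let ?x = "u \<circ> transpose i m"
    let ?y = "?x \<circ> transpose i j"
    let ?z = "?y \<circ> transpose m j"
    have x: "?x permutes {1..n}" using permutes_comp_transpose[OF u i mn] .
    have y: "?y permutes {1..n}" using permutes_comp_transpose[OF x i j] .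
    have ux: "bruhat_less n u ?x"
      by (intro bruhat_step_imp_less bruhat_stepI) (use u i mn m in auto)
    have "bruhat_less n ?x ?y"
      by (intro bruhat_step_imp_less bruhat_stepI) (use x i j m in \<open>auto simp: transpose_def\<close>)
    moreover have "bruhat_less n ?y ?z"
      by (intro bruhat_step_imp_less bruhat_stepI) (use y mn j m in \<open>auto simp: transpose_def\<close>)
    ultimately have "bruhat_less n ?x ?z" by (rule bruhat_less_trans)
    moreover have "?z = ?v"
      using m by (auto simp: fun_eq_iff transpose_def)
    ultimately show False
      using ux cover unfolding bruhat_cover_def by metis
  qed
next
  let ?v = "u \<circ> transpose i j"
  assume *: "?less \<and> ?gap"
  have "bruhat_less n u ?v"
    by (intro bruhat_step_imp_less bruhat_stepI) (use u i j \<open>i < j\<close> * in auto)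
  moreover have "card (inversions n ?v) = Suc (card (inversions n u))"
    by (rule card_inversions_Suc) (use i j \<open>i < j\<close> * permutes_inj[OF u] in auto)
  ultimately show ?cover
    unfolding bruhat_cover_def using bruhat_less_card by (metis Suc_leI leD)
qed


section \<open>Longest increasing subsequences\<close>

definition increasing_from :: "nat \<Rightarrow> (nat \<Rightarrow> nat) \<Rightarrow> nat \<Rightarrow> nat list \<Rightarrow> bool" where
  "increasing_from n w i \<alpha> \<longleftrightarrow> \<alpha> \<noteq> [] \<and> hd \<alpha> = i \<and> set \<alpha> \<subseteq> {1..n} \<and>
     sorted_wrt (<) \<alpha> \<and> sorted_wrt (<) (map w \<alpha>)"

lemma increasing_from_length_le: "increasing_from n w i \<alpha> \<Longrightarrow> length \<alpha> \<le> n"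
proof -
  assume "increasing_from n w i \<alpha>"
  then have "distinct \<alpha>" "set \<alpha> \<subseteq> {1..n}"
    by (auto simp: increasing_from_def strict_sorted_iff)
  then show ?thesis
    by (metis card_atLeastAtMost card_mono diff_Suc_1 distinct_card finite_atLeastAtMost)
qed

lemma rajcode_eq_Max: "rajcode n w i = Max (length ` {\<alpha>. increasing_from n w i \<alpha>}) - 1"
  unfolding rajcode_def increasing_from_def by (simp add: setcompr_eq_image)

lemma finite_increasing_lengths: "finite (length ` {\<alpha>. increasing_from n w i \<alpha>})"
  by (rule finite_subset[of _ "{..n}"]) (auto dest: increasing_from_length_le)

lemma rajcode_ge: "increasing_from n w i \<alpha> \<Longrightarrow> length \<alpha> \<le> Suc (rajcode n w i)"
proof -
  assume "increasing_from n w i \<alpha>"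
  then have "length \<alpha> \<le> Max (length ` {\<alpha>. increasing_from n w i \<alpha>})"
    by (intro Max_ge finite_increasing_lengths) auto
  then show ?thesis unfolding rajcode_eq_Max by simp
qed

lemma rajcode_attained:
  assumes "i \<in> {1..n}"
  obtains \<alpha> where "increasing_from n w i \<alpha>" "length \<alpha> = Suc (rajcode n w i)"
proof -
  have "increasing_from n w i [i]"
    using assms by (simp add: increasing_from_def)
  then have "Max (length ` {\<alpha>. increasing_from n w i \<alpha>}) \<in> length ` {\<alpha>. increasing_from n w i \<alpha>}"
    by (intro Max_in finite_increasing_lengths) auto
  then obtain \<alpha> where \<alpha>: "increasing_from n w i \<alpha>"
    "length \<alpha> = Max (length ` {\<alpha>. increasing_from n w i \<alpha>})"
    by auto
  \<comment> \<open>The truncated subtraction of one in the code is harmless because the maximal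
    length is positive.\<close>
  from \<alpha>(1) have "length \<alpha> > 0" by (simp add: increasing_from_def)
  with \<alpha> that show thesis unfolding rajcode_eq_Max by simp
qed

text \<open>Put \<open>i\<close> in front of a longest sequence starting at
  \<open>j\<close>.\<close>

lemma rajcode_less:
  assumes "i \<in> {1..n}" "j \<in> {1..n}" "i < j" "w i < w j"
  shows "rajcode n w j < rajcode n w i"
proof -
  obtain \<alpha> where \<alpha>: "increasing_from n w j \<alpha>" "length \<alpha> = Suc (rajcode n w j)"
    using rajcode_attained[OF assms(2)] .
  then obtain \<beta> where "\<alpha> = j # \<beta>"
    by (cases \<alpha>) (auto simp: increasing_from_def)
  with \<alpha>(1) assms have "increasing_from n w i (i # \<alpha>)"
    by (auto simp: increasing_from_def)
  from rajcode_ge[OF this] \<alpha>(2) show ?thesis by simp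
qed

text \<open>Take for \<open>j\<close> the second position of a longest sequence starting at
  \<open>i\<close>.\<close>

lemma rajcode_step:
  assumes "i \<in> {1..n}" "rajcode n w i \<noteq> 0"
  obtains j where "j \<in> {1..n}" "i < j" "w i < w j" "rajcode n w i \<le> Suc (rajcode n w j)"
proof -
  obtain \<alpha> where \<alpha>: "increasing_from n w i \<alpha>" "length \<alpha> = Suc (rajcode n w i)"
    using rajcode_attained[OF assms(1)] .
  with assms(2) obtain j \<beta> where eq: "\<alpha> = i # j # \<beta>"
    by (cases \<alpha>; cases "tl \<alpha>") (auto simp: increasing_from_def)
  with \<alpha> have "increasing_from n w j (j # \<beta>)"
    by (auto simp: increasing_from_def)
  from rajcode_ge[OF this] show thesis
    using \<alpha> eq that[of j] by (auto simp: increasing_from_def)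
qed

text \<open>The two properties of the previous lemmas determine the code.\<close>

lemma rajcode_unique:
  assumes less: "\<And>i j. \<lbrakk>i \<in> {1..n}; j \<in> {1..n}; i < j; w i < w j\<rbrakk> \<Longrightarrow> g j < g i"
    and step: "\<And>i. \<lbrakk>i \<in> {1..n}; g i \<noteq> 0\<rbrakk> \<Longrightarrow>
      \<exists>j\<in>{1..n}. i < j \<and> w i < w j \<and> g i \<le> Suc (g j)"
    and "i \<in> {1..n}"
  shows "rajcode n w i = g i"
  using assms(3)
\<comment> \<open>Both properties relate a position only to positions on its right, so the induction
  runs from \<open>n\<close> downwards.\<close>
proof (induction "n - i" arbitrary: i rule: less_induct)
  case less
  have IH: "rajcode n w j = g j" if "j \<in> {1..n}" "i < j" for j
    using less.hyps[of j] that less.prems by auto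
  show ?case
  proof (rule antisym)
    show "rajcode n w i \<le> g i"
    proof (cases "rajcode n w i = 0")
      case False
      then obtain j where "j \<in> {1..n}" "i < j" "w i < w j" "rajcode n w i \<le> Suc (rajcode n w j)"
        using rajcode_step[OF less.prems] by blast
      with IH[of j] assms(1)[of i j] less.prems show ?thesis by simp
    qed simp
    show "g i \<le> rajcode n w i"
    proof (cases "g i = 0")
      case False
      then obtain j where "j \<in> {1..n}" "i < j" "w i < w j" "g i \<le> Suc (g j)"
        using step[OF less.prems] by blast
      with IH[of j] rajcode_less[of i n j w] less.prems show ?thesis by simp
    qed simp
  qed
qed

lemma raj_w0: "raj n (w0 n) = 0"
proof -
  have "rajcode n (w0 n) i = 0" if "i \<in> {1..n}" for i
    by (rule rajcode_unique[where g = "\<lambda>_. 0"]) (use that in \<open>auto simp: w0_def\<close>)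
  then show ?thesis by (simp add: raj_def)
qed


section \<open>Chains of links\<close>

lemma apply_links_simps [simp]:
  "apply_links w [] = w"
  "apply_links w ((i, j) # C) = apply_links (w \<circ> transpose i j) C"
  "apply_links w (C @ D) = apply_links (apply_links w C) D"
  by (auto simp: apply_links_def)

text \<open>Recursive form of the cover condition in \<open>climbing_chain\<close>, suited to
  concatenation.\<close>

fun covering_chain :: "nat \<Rightarrow> (nat \<Rightarrow> nat) \<Rightarrow> (nat \<times> nat) list \<Rightarrow> bool" where
  "covering_chain n w [] \<longleftrightarrow> True"
| "covering_chain n w ((i, j) # C) \<longleftrightarrow>
     bruhat_cover n w (w \<circ> transpose i j) \<and> covering_chain n (w \<circ> transpose i j) C"

lemma covering_chain_append [simp]:
  "covering_chain n w (C @ D) \<longleftrightarrow> covering_chain n w C \<and> covering_chain n (apply_links w C) D"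
  by (induction C arbitrary: w) auto

lemma covering_chain_iff:
  "covering_chain n w C \<longleftrightarrow>
     (\<forall>p<length C. bruhat_cover n (apply_links w (take p C)) (apply_links w (take (Suc p) C)))"
  by (induction C arbitrary: w) (auto simp: All_less_Suc2)

definition ascends :: "nat \<times> nat \<Rightarrow> nat \<times> nat \<Rightarrow> bool" where
  "ascends l c \<longleftrightarrow> fst l < fst c \<or> fst l = fst c \<and> snd l < snd c"

text \<open>The argument \<open>l\<close> plays the link preceding the list, so that markings of a
  concatenation can be computed piece by piece.\<close>

fun marked_after :: "nat \<times> nat \<Rightarrow> (nat \<times> nat) list \<Rightarrow> (nat \<times> nat) set" where
  "marked_after l [] = {}"
| "marked_after l (c # C) = (if ascends l c then {c} else {}) \<union> marked_after c C"

lemma in_marked_after_iff: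
  "x \<in> marked_after l C \<longleftrightarrow> (\<exists>p<length C. x = C ! p \<and> ascends ((l # C) ! p) (C ! p))"
  by (induction C arbitrary: l) (simp_all add: Ex_less_Suc2)

lemma minimal_markings_eq: "minimal_markings C = marked_after (0, 0) C"
proof (rule set_eqI)
  fix x
  let ?D = "(0, 0) # C"
  have "x \<in> minimal_markings C \<longleftrightarrow>
      (\<exists>p\<in>{1..length C}. x = ?D ! p \<and> ascends (?D ! (p - 1)) (?D ! p))"
    unfolding minimal_markings_def Let_def ascends_def by blast
  also have "{1..length C} = Suc ` {..<length C}"
    by (simp add: lessThan_atLeast0 image_Suc_atLeastLessThan atLeastLessThanSuc_atLeastAtMost)
  finally show "x \<in> minimal_markings C \<longleftrightarrow> x \<in> marked_after (0, 0) C"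
    by (simp add: in_marked_after_iff Bex_def)
qed

lemma marked_after_subset: "marked_after l C \<subseteq> set C"
  by (induction C arbitrary: l) auto

text \<open>No link of a descending run is marked after its predecessor; the run affects what
  follows only through its last link.\<close>

lemma marked_after_descending:
  "sorted_wrt (>) (b # bs) \<Longrightarrow>
     marked_after (a, b) (map (Pair a) bs @ C) = marked_after (a, last (b # bs)) C"
  by (induction bs arbitrary: b) (auto simp: ascends_def)


lemma apply_links_permutes:
  assumes "w permutes A" "\<And>i j. (i, j) \<in> set C \<Longrightarrow> i \<in> A \<and> j \<in> A"
  shows "apply_links w C permutes A"
  using assms
proof (induction C arbitrary: w)
  case (Cons l C)
  obtain i j where "l = (i, j)" by (cases l)
  with Cons show ?case
    using permutes_comp_transpose[OF Cons.prems(1), of i j] by auto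
qed simp


section \<open>Cyclic shifts\<close>

text \<open>For \<open>a < min S\<close> this is the cycle \<open>a \<mapsto> min S \<mapsto> \<dots> \<mapsto> max S \<mapsto> a\<close>.\<close>

definition shift :: "nat \<Rightarrow> nat set \<Rightarrow> nat \<Rightarrow> nat" where
  "shift a S x =
     (if x = a then Min S
      else if x \<notin> S then x
      else if x = Max S then a else Min {t \<in> S. x < t})"

lemma shift_outside: "x \<noteq> a \<Longrightarrow> x \<notin> S \<Longrightarrow> shift a S x = x"
  by (simp add: shift_def)

lemma shift_start: "shift a S a = Min S"
  by (simp add: shift_def)

lemma shift_Max: "finite S \<Longrightarrow> S \<noteq> {} \<Longrightarrow> a \<notin> S \<Longrightarrow> shift a S (Max S) = a"
  using Max_in by (auto simp: shift_def)

lemma shift_next: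
  assumes "finite S" "s \<in> S" "s \<noteq> Max S" "a \<notin> S"
  shows "shift a S s \<in> S" "s < shift a S s" "\<And>t. t \<in> S \<Longrightarrow> s < t \<Longrightarrow> shift a S s \<le> t"
proof -
  have eq: "shift a S s = Min {t \<in> S. s < t}"
    using assms by (auto simp: shift_def)
  have "s < Max S" using assms by (simp add: order.not_eq_order_implies_strict)
  then have "{t \<in> S. s < t} \<noteq> {}" using assms Max_in by blast
  then have "shift a S s \<in> {t \<in> S. s < t}"
    unfolding eq using assms by (intro Min_in) auto
  then show "shift a S s \<in> S" "s < shift a S s" by auto
  show "shift a S s \<le> t" if "t \<in> S" "s < t" for t
    unfolding eq using that assms by (intro Min_le) auto
qed

text \<open>The new minimum \<open>c\<close> enters the cycle between \<open>a\<close> and the old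
  minimum: \<open>a\<close> now goes to \<open>c\<close>, and \<open>c\<close> to
  \<open>Min S\<close>.\<close>

lemma shift_insert:
  assumes "finite S" "S \<noteq> {}" "a < c" "\<And>s. s \<in> S \<Longrightarrow> c < s"
  shows "shift a S \<circ> transpose a c = shift a (insert c S)"
proof
  fix x
  have Mx: "Max (insert c S) = Max S"
    using assms by (simp add: max_absorb2 less_imp_le)
  have Mn: "Min (insert c S) = c"
    using assms by (intro Min_eqI) (auto simp: less_imp_le)
  have c: "c \<notin> S" "Max S \<noteq> c"
    using assms(4)[of c] assms(4)[OF Max_in[OF assms(1,2)]] by auto
  consider "x = a" | "x = c" | "x \<noteq> a" "x \<noteq> c" "x \<in> S" | "x \<noteq> a" "x \<noteq> c" "x \<notin> S"
    by blast
  then show "(shift a S \<circ> transpose a c) x = shift a (insert c S) x"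
  proof cases
    case 1
    with c assms Mn show ?thesis by (simp add: shift_def)
  next
    case 2
    have "{t. (t = c \<or> t \<in> S) \<and> c < t} = S" using assms by auto
    with 2 c assms Mx show ?thesis by (simp add: shift_def)
  next
    case 3
    then have "{t. (t = c \<or> t \<in> S) \<and> x < t} = {t \<in> S. x < t}" using assms(4)[of x] by auto
    with 3 Mx show ?thesis by (simp add: shift_def)
  next
    case 4
    then show ?thesis by (simp add: shift_def)
  qed
qed

lemma apply_links_descending:
  assumes "bs \<noteq> []" "sorted_wrt (>) bs" "\<And>b. b \<in> set bs \<Longrightarrow> a < b"
  shows "apply_links w (map (Pair a) bs) = w \<circ> shift a (set bs)"
  using assms
\<comment> \<open>The last link has the smallest second component, so removing it fits
  \<open>shift_insert\<close>.\<close>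
proof (induction bs rule: rev_nonempty_induct)
  case (single b)
  have "transpose a b = shift a {b}" by (auto simp: shift_def transpose_def)
  then show ?case by simp
next
  case (snoc c bs)
  have "shift a (set bs) \<circ> transpose a c = shift a (insert c (set bs))"
    using snoc by (intro shift_insert) (auto simp: sorted_wrt_append)
  moreover have "apply_links w (map (Pair a) bs) = w \<circ> shift a (set bs)"
    using snoc by (auto simp: sorted_wrt_append)
  ultimately show ?case by (simp add: comp_assoc)
qed


section \<open>One staircase\<close>

lemma rajcode_maximizers_nonempty:
  assumes "finite A" "A \<noteq> {}"
  shows "rajcode_maximizers n w A \<noteq> {}"
proof -
  have "Max (rajcode n w ` A) \<in> rajcode n w ` A"
    using assms by (intro Max_in) auto
  then obtain k where "k \<in> A" "rajcode n w k = Max (rajcode n w ` A)" by auto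
  with assms(1) have "k \<in> rajcode_maximizers n w A"
    by (simp add: rajcode_maximizers_def)
  then show ?thesis by blast
qed

text \<open>A maximizer at or before \<open>k\<close> would have an entry at most that of
  \<open>k\<close>, making \<open>k\<close> a maximizer too. So a left-to-right maximum that is not
  chosen remains available to the next block.\<close>

lemma less_Min_rajcode_maximizers:
  assumes "finite A" "k \<in> A" "k \<notin> rajcode_maximizers n w A"
    and "\<And>k'. k' \<in> A \<Longrightarrow> k' < k \<Longrightarrow> rajcode n w k' \<le> rajcode n w k"
  shows "rajcode_maximizers n w A \<noteq> {}" "k < Min (rajcode_maximizers n w A)"
proof -
  show ne: "rajcode_maximizers n w A \<noteq> {}"
    using assms by (intro rajcode_maximizers_nonempty) auto
  have fin: "finite (rajcode_maximizers n w A)"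
    using assms(1) by (simp add: rajcode_maximizers_def)
  have "k < s" if s: "s \<in> rajcode_maximizers n w A" for s
  proof (rule ccontr)
    assume "\<not> k < s"
    with s assms have "rajcode n w s \<le> rajcode n w k"
      by (cases "s = k") (auto simp: rajcode_maximizers_def)
    with s assms(2) have "k \<in> rajcode_maximizers n w A"
      by (auto simp: rajcode_maximizers_def intro: order_trans)
    with assms(3) show False ..
  qed
  with ne fin show "k < Min (rajcode_maximizers n w A)" by simp
qed

section \<open>Setting of a single staircase and its first defect\<close>

locale staircase_step =
  fixes n :: nat and w :: "nat \<Rightarrow> nat"
  assumes perm: "w permutes {1..n}" and neq: "w \<noteq> w0 n"
begin

abbreviation r :: "nat \<Rightarrow> nat" where "r \<equiv> rajcode n w"

definition a :: nat where "a = first_defect n w"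

definition K :: "nat set" where "K = cover_positions n w"

definition S :: "nat set" where "S = (\<Union>p. stair_block n w p)"

definition \<sigma> :: "nat \<Rightarrow> nat" where "\<sigma> = shift a S"

definition u :: "nat \<Rightarrow> nat" where "u = apply_links w (stair n w)"

lemma w_eq_iff [simp]: "w x = w y \<longleftrightarrow> x = y"
  using permutes_inj[OF perm] by (auto dest: injD)

lemma w_mem: "x \<in> {1..n} \<Longrightarrow> w x \<in> {1..n}"
  using permutes_in_image[OF perm] by blast

lemma a_mem: "a \<in> {1..n}" and w_a_neq: "w a \<noteq> n + 1 - a"
  and w_before_a: "\<And>k. k \<in> {1..n} \<Longrightarrow> k < a \<Longrightarrow> w k = n + 1 - k"
proof -
  let ?D = "{k \<in> {1..n}. w k \<noteq> n + 1 - k}"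
  from neq obtain k where k: "w k \<noteq> w0 n k" by auto
  then have "k \<in> ?D"
    using permutes_not_in[OF perm, of k] by (cases "k \<in> {1..n}") (auto simp: w0_def)
  then have "a \<in> ?D" unfolding a_def first_defect_def by (intro Min_in) auto
  then show "a \<in> {1..n}" "w a \<noteq> n + 1 - a" by auto
  show "w k = n + 1 - k" if "k \<in> {1..n}" "k < a" for k
  proof (rule ccontr)
    assume "w k \<noteq> n + 1 - k"
    with that have "a \<le> k" unfolding a_def first_defect_def by (intro Min_le) auto
    with that show False by simp
  qed
qed

text \<open>Every value from \<open>n + 1 - x\<close> upwards is already taken at a position up to
  \<open>x\<close>, where \<open>w\<close> agrees with \<open>w0 n\<close>.\<close>

lemma w_less_before_a:
  assumes "x \<in> {1..n}" "y \<in> {1..n}" "x < a" "x < y"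
  shows "w y < w x"
proof (rule ccontr)
  assume "\<not> w y < w x"
  then have *: "n + 1 - x \<le> w y" using w_before_a[OF assms(1,3)] by simp
  \<comment> \<open>This is the position where \<open>w0 n\<close> has the value
    \<open>w y\<close>.\<close>
  let ?z = "n + 1 - w y"
  have "?z \<in> {1..n}" "?z \<le> x" using * w_mem[OF assms(2)] assms by auto
  then have "w ?z = w y"
    using w_before_a[of ?z] assms w_mem[OF assms(2)] by auto
  then have "?z = y" by (simp only: w_eq_iff)
  with \<open>?z \<le> x\<close> assms show False by simp
qed

lemma w_a_less: "w a < n + 1 - a"
proof (rule ccontr)
  assume "\<not> w a < n + 1 - a"
  with w_a_neq have *: "n + 1 - a < w a" by simp
  let ?z = "n + 1 - w a"
  have "?z \<in> {1..n}" "?z < a" using * w_mem[OF a_mem] a_mem by auto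
  then have "w ?z = w a"
    using w_before_a[of ?z] w_mem[OF a_mem] by auto
  then have "?z = a" by (simp only: w_eq_iff)
  with \<open>?z < a\<close> show False by simp
qed

section \<open>The cover positions\<close>

lemma K_iff:
  "k \<in> K \<longleftrightarrow> k \<in> {1..n} \<and> a < k \<and> w a < w k \<and>
     (\<forall>m. a < m \<longrightarrow> m < k \<longrightarrow> \<not> (w a < w m \<and> w m < w k))"
  using bruhat_cover_transpose_iff[OF perm a_mem, of k]
  unfolding K_def cover_positions_def Let_def a_def[symmetric] by blast

lemma K_gap: "k \<in> K \<Longrightarrow> a < m \<Longrightarrow> m < k \<Longrightarrow> w m < w k \<Longrightarrow> w m < w a"
  using w_eq_iff[of m a] unfolding K_iff by (metis linorder_neqE_nat nat_neq_iff)

lemma finite_K: "finite K"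
  by (rule finite_subset[of _ "{1..n}"]) (auto simp: K_iff)

lemma K_antimono: "k \<in> K \<Longrightarrow> l \<in> K \<Longrightarrow> k < l \<Longrightarrow> w l < w k"
  using w_eq_iff[of k l] unfolding K_iff by (metis linorder_neqE_nat nat_neq_iff)

text \<open>Among the positions after \<open>a\<close> and up to \<open>m\<close> with values above
  \<open>w a\<close>, the one of least value has nothing in its gap. This lets cover positions
  replace arbitrary positions above \<open>w a\<close>.\<close>

lemma K_below:
  assumes "m \<in> {1..n}" "a < m" "w a < w m"
  obtains k where "k \<in> K" "k \<le> m" "w k \<le> w m"
proof -
  let ?P = "\<lambda>k. a < k \<and> k \<le> m \<and> w a < w k"
  have "?P m" using assms by auto
  from ex_has_least_nat[of ?P, OF this, of w]
  obtain k where k: "?P k" "\<And>y. ?P y \<Longrightarrow> w k \<le> w y" by auto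
  have "\<not> (w a < w j \<and> w j < w k)" if "a < j" "j < k" for j
    using k(1) k(2)[of j] that by auto
  then have "k \<in> K" using k(1) assms unfolding K_iff by auto
  with k assms that show thesis by auto
qed

text \<open>The value \<open>Suc (w a)\<close> must occur after \<open>a\<close>, since all
  positions before \<open>a\<close> carry larger values.\<close>

lemma K_nonempty: "K \<noteq> {}"
proof -
  have "Suc (w a) \<in> {1..n}" using w_a_less a_mem by auto
  then obtain k where k: "k \<in> {1..n}" "w k = Suc (w a)"
    using permutes_image[OF perm] by (metis imageE)
  have "\<not> k < a"
  proof
    assume "k < a"
    with k have "Suc (w a) = n + 1 - k" using w_before_a[of k] by simp
    with \<open>k < a\<close> w_a_less a_mem show False by simp
  qed
  moreover have "k \<noteq> a" using k by auto
  ultimately show ?thesis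
    using K_below[of k] k by auto
qed

section \<open>The blocks and the left-to-right maxima of the code\<close>

text \<open>Each block maximizes the code over an initial segment of \<open>K\<close>, so its
  members dominate all earlier entries. Conversely, a left-to-right maximum that is never selected
  would stay below every block, and the minima of the blocks would descend forever.\<close>

lemma S_eq: "S = {k \<in> K. \<forall>k'\<in>K. k' < k \<longrightarrow> r k' \<le> r k}"
proof (intro set_eqI iffI)
  fix k assume "k \<in> S"
  then obtain p where p: "k \<in> stair_block n w p" by (auto simp: S_def)
  show "k \<in> {k \<in> K. \<forall>k'\<in>K. k' < k \<longrightarrow> r k' \<le> r k}"
    using p by (cases p) (auto simp: rajcode_maximizers_def K_def split: if_splits)
next
  fix k assume "k \<in> {k \<in> K. \<forall>k'\<in>K. k' < k \<longrightarrow> r k' \<le> r k}"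
  then have k: "k \<in> K" and rec: "\<And>k'. k' \<in> K \<Longrightarrow> k' < k \<Longrightarrow> r k' \<le> r k" by auto
  show "k \<in> S"
  proof (rule ccontr)
    assume "k \<notin> S"
    then have notin: "k \<notin> stair_block n w p" for p by (auto simp: S_def)
    have *: "stair_block n w p \<noteq> {} \<and> k < Min (stair_block n w p)" for p
    proof (induction p)
      case 0
      show ?case
        using less_Min_rajcode_maximizers[OF finite_K k _ rec] notin[of 0]
        by (simp add: K_def)
    next
      case (Suc p)
      let ?A = "{k \<in> K. k < Min (stair_block n w p)}"
      have eq: "stair_block n w (Suc p) = rajcode_maximizers n w ?A"
        using Suc.IH by (simp add: K_def)
      have "finite ?A" "k \<in> ?A" using finite_K k Suc.IH by auto
      then show ?case
        using less_Min_rajcode_maximizers[of ?A k n w] rec notin[of "Suc p"]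
        unfolding eq by auto
    qed
    have "Min (stair_block n w (Suc p)) < Min (stair_block n w p)" for p
    proof -
      have sub: "stair_block n w (Suc p) \<subseteq> {k \<in> K. k < Min (stair_block n w p)}"
        by (auto simp: rajcode_maximizers_def K_def)
      then have "finite (stair_block n w (Suc p))"
        by (rule finite_subset) (simp add: finite_K)
      then have "Min (stair_block n w (Suc p)) \<in> stair_block n w (Suc p)"
        using *[of "Suc p"] by (intro Min_in) blast+
      with sub show ?thesis by blast
    qed
    then have "\<exists>f :: nat \<Rightarrow> nat. \<forall>i. (f (Suc i), f i) \<in> less_than"
      by (intro exI[of _ "\<lambda>p. Min (stair_block n w p)"]) simp
    then show False
      using wf_less_than unfolding wf_iff_no_infinite_down_chain by blast
  qed
qed

lemma S_subset_K: "S \<subseteq> K"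
  by (auto simp: S_eq)

lemma S_mono: "s \<in> S \<Longrightarrow> t \<in> S \<Longrightarrow> s \<le> t \<Longrightarrow> r s \<le> r t"
  by (cases "s = t") (auto simp: S_eq)

lemma finite_S [simp]: "finite S"
  using finite_subset[OF S_subset_K finite_K] .

text \<open>The least earlier cover position whose entry exceeds \<open>r k\<close> is itself a
  left-to-right maximum.\<close>

lemma S_skip:
  assumes "k \<in> K" "k \<notin> S"
  obtains s where "s \<in> S" "s < k" "r k < r s"
proof -
  let ?P = "\<lambda>s. s \<in> K \<and> s < k \<and> r k < r s"
  from assms have "\<exists>s. ?P s" by (auto simp: S_eq not_le)
  then obtain s where s: "?P s" "\<And>t. t < s \<Longrightarrow> \<not> ?P t"
    using exists_least_iff[of ?P] by auto
  have "r t \<le> r s" if "t \<in> K" "t < s" for t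
    using s(1) s(2)[OF that(2)] that by auto
  with s(1) have "s \<in> S" by (auto simp: S_eq)
  with s(1) that show thesis by blast
qed

lemma S_nonempty [simp]: "S \<noteq> {}"
  using K_nonempty S_skip by blast

lemma S_Min_le: "k \<in> K \<Longrightarrow> Min S \<le> k"
  by (cases "k \<in> S") (auto elim!: S_skip intro: Min_le order_trans[OF Min_le])

lemma S_mem: "s \<in> S \<Longrightarrow> s \<in> {1..n}" and S_gt_a: "s \<in> S \<Longrightarrow> a < s"
  and S_w_gt: "s \<in> S \<Longrightarrow> w a < w s"
  using S_subset_K by (auto simp: K_iff)

lemma a_notin_S [simp]: "a \<notin> S"
  using S_gt_a by blast

lemma S_antimono: "s \<in> S \<Longrightarrow> t \<in> S \<Longrightarrow> s < t \<Longrightarrow> w t < w s"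
  using K_antimono S_subset_K by blast

lemma S_antimono_le: "s \<in> S \<Longrightarrow> t \<in> S \<Longrightarrow> s \<le> t \<Longrightarrow> w t \<le> w s"
  using S_antimono[of s t] by (cases "s = t") simp_all

lemma Min_S_mem [simp]: "Min S \<in> S" and Max_S_mem [simp]: "Max S \<in> S"
  by (simp_all add: Min_in Max_in)

lemma r_le_of_below:
  assumes "k \<in> {1..n}" "m \<in> {1..n}" "k \<le> m" "w k \<le> w m"
  shows "r m \<le> r k"
proof (cases "k = m")
  case False
  with assms have "k < m" "w k < w m" using w_eq_iff[of k m] by linarith+
  with rajcode_less[of k n m w] assms show ?thesis by simp
qed simp

lemma r_K_le: "k \<in> K \<Longrightarrow> r k \<le> r (Max S)"
proof (cases "k \<in> S")
  case True
  then show ?thesis by (simp add: S_mono)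
next
  case False
  assume "k \<in> K"
  then obtain s where "s \<in> S" "r k < r s" using False by (rule S_skip)
  with S_mono[of s "Max S"] show ?thesis by simp
qed

text \<open>The second position of a longest sequence from \<open>a\<close> can be replaced by a
  cover position with at least the same entry, and the largest entry on \<open>K\<close> is found at
  \<open>Max S\<close>.\<close>

lemma r_a: "r a = Suc (r (Max S))"
proof (rule antisym)
  show "Suc (r (Max S)) \<le> r a"
    using rajcode_less[of a n "Max S" w] a_mem S_mem S_gt_a S_w_gt Max_S_mem by (simp add: Suc_leI)
  show "r a \<le> Suc (r (Max S))"
  proof (cases "r a = 0")
    case False
    then obtain m where m: "m \<in> {1..n}" "a < m" "w a < w m" "r a \<le> Suc (r m)"
      using rajcode_step[OF a_mem] by blast
    then obtain k where k: "k \<in> K" "k \<le> m" "w k \<le> w m" using K_below by blast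
    then have "r m \<le> r k" using m by (intro r_le_of_below) (auto simp: K_iff)
    with m r_K_le[OF k(1)] show ?thesis by simp
  qed simp
qed

section \<open>The permutation after one staircase\<close>

lemma stair_eq: "stair n w = map (Pair a) (rev (sorted_list_of_set S))"
  by (simp add: stair_def a_def S_def)

lemma descending_S: "sorted_wrt (>) (rev (sorted_list_of_set S))"
  by (simp add: sorted_wrt_rev)

lemma u_eq: "u = w \<circ> \<sigma>"
  unfolding u_def stair_eq \<sigma>_def
  using apply_links_descending[OF _ descending_S, of a w] S_gt_a by simp

lemma u_permutes: "u permutes {1..n}"
  unfolding u_def using perm a_mem S_mem by (intro apply_links_permutes) (auto simp: stair_eq)

lemma \<sigma>_permutes: "\<sigma> permutes {1..n}"
proof -
  \<comment> \<open>Starting the links at the identity isolates the cycle as a product of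
    transpositions.\<close>
  have "\<sigma> = apply_links id (stair n w)"
    unfolding stair_eq \<sigma>_def
    using apply_links_descending[OF _ descending_S, of a id] S_gt_a by simp
  then show ?thesis
    using permutes_id a_mem S_mem by (auto intro!: apply_links_permutes simp: stair_eq)
qed

lemma u_a: "u a = w (Min S)"
  by (simp add: u_eq \<sigma>_def shift_start)

lemma u_outside: "x \<noteq> a \<Longrightarrow> x \<notin> S \<Longrightarrow> u x = w x"
  by (simp add: u_eq \<sigma>_def shift_outside)

lemma u_Max: "u (Max S) = w a"
  by (simp add: u_eq \<sigma>_def shift_Max)

lemma \<sigma>_next:
  assumes "s \<in> S" "s \<noteq> Max S"
  shows "\<sigma> s \<in> S" "s < \<sigma> s" "\<And>t. t \<in> S \<Longrightarrow> s < t \<Longrightarrow> \<sigma> s \<le> t"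
  using shift_next[OF finite_S assms a_notin_S] unfolding \<sigma>_def by blast+

lemma u_S: "s \<in> S \<Longrightarrow> s \<noteq> Max S \<Longrightarrow> u s = w (\<sigma> s)"
  by (simp add: u_eq)

lemma u_S_ge: "s \<in> S \<Longrightarrow> w a \<le> u s"
  by (cases "s = Max S") (auto simp: u_Max u_S intro!: less_imp_le S_w_gt \<sigma>_next)

lemma u_S_less: "s \<in> S \<Longrightarrow> u s < w s"
  by (cases "s = Max S") (auto simp: u_Max u_S intro!: S_w_gt S_antimono \<sigma>_next)

lemma w_le_w_Min: "s \<in> S \<Longrightarrow> w s \<le> w (Min S)"
  by (simp add: S_antimono_le)

lemma u_S_antimono:
  assumes "s \<in> S" "t \<in> S" "s < t"
  shows "u t < u s"
proof -
  have s: "s \<noteq> Max S" using assms Max_ge[OF finite_S assms(2)] by linarith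
  have "w t \<le> u s"
    using S_antimono_le[OF \<sigma>_next(1)[OF assms(1) s] assms(2) \<sigma>_next(3)[OF assms(1) s assms(2,3)]]
    by (simp add: u_eq)
  with u_S_less[OF assms(2)] show ?thesis by simp
qed

text \<open>Values at positions in \<open>S\<close> have dropped and are less than
  \<open>w (Min S)\<close>, which is \<open>u a\<close>. This controls the links of later staircases
  that still have first component \<open>a\<close>.\<close>

lemma u_greater_u_a:
  assumes "j \<in> {1..n}" "a < j" "u a < u j"
  shows "j \<notin> S" "w a < w j" "Min S < j"
proof -
  show "j \<notin> S"
    using u_S_less[of j] w_le_w_Min[of j] assms(3) u_a by linarith
  then have uj: "u j = w j" using assms u_outside by simp
  then show wj: "w a < w j"
    using S_w_gt[of "Min S"] assms u_a by simp
  obtain k where "k \<in> K" "k \<le> j" using K_below[OF assms(1,2) wj] .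
  then have "Min S \<le> j" using S_Min_le order_trans by blast
  with \<open>j \<notin> S\<close> show "Min S < j" using Min_S_mem by (metis le_neq_implies_less)
qed

section \<open>The code after one staircase\<close>

text \<open>
  The code of \<open>u\<close> is that of \<open>w\<close> pulled back along \<open>\<sigma>\<close>, except that \<open>max S\<close> keeps its entry
  instead of inheriting the entry \<open>r a = r (max S) + 1\<close>.
\<close>

definition \<tau> :: "nat \<Rightarrow> nat" where "\<tau> x = (if x = Max S then x else \<sigma> x)"

lemma \<tau>_a: "\<tau> a = Min S"
  using a_notin_S Max_S_mem by (auto simp: \<tau>_def \<sigma>_def shift_start simp del: a_notin_S)

lemma \<tau>_outside: "x \<noteq> a \<Longrightarrow> x \<notin> S \<Longrightarrow> \<tau> x = x"
  using Max_S_mem by (auto simp: \<tau>_def \<sigma>_def shift_outside)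

lemma \<tau>_S:
  assumes "s \<in> S"
  shows "\<tau> s \<in> S" "s \<le> \<tau> s" "u s \<le> w (\<tau> s)"
  using assms \<sigma>_next[OF assms] S_w_gt[of "Max S"]
  by (cases "s = Max S"; simp add: \<tau>_def u_Max u_S less_imp_le)+

text \<open>The delicate case is a \<open>y\<close> that exceeds \<open>u s\<close> but not
  \<open>w s\<close>, with no further element of \<open>S\<close> before \<open>y\<close>. A cover
  position \<open>k\<close> below \<open>y\<close> was then skipped in favour of some
  \<open>t\<close> in \<open>S\<close> with larger entry, and \<open>t \<le> s\<close>, so
  \<open>r y \<le> r k < r t \<le> r (\<tau> s)\<close>.\<close>

lemma r_less_\<tau>:
  assumes s: "s \<in> S" and y: "y \<in> {1..n}" "y \<notin> S" "s < y" "u s < w y"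
  shows "r y < r (\<tau> s)"
proof (cases "w s < w y")
  case True
  then have "r y < r s" using S_mem[OF s] y by (intro rajcode_less) auto
  also have "r s \<le> r (\<tau> s)" using \<tau>_S[OF s] s by (intro S_mono)
  finally show ?thesis .
next
  case False
  show ?thesis
  proof (cases "s \<noteq> Max S \<and> \<sigma> s < y")
    case True
    then have "r y < r (\<sigma> s)"
      using \<sigma>_next(1)[OF s] S_mem y by (intro rajcode_less) (auto simp: u_eq)
    with True show ?thesis by (simp add: \<tau>_def)
  next
    case before: False
    have ay: "a < y" "w a < w y" using S_gt_a[OF s] u_S_ge[OF s] y by auto
    obtain k where k: "k \<in> K" "k \<le> y" "w k \<le> w y" using K_below[OF y(1) ay] .
    have "y \<noteq> s" using y s by blast
    then have wk: "w k < w s" using False k(3) w_eq_iff[of y s] by linarith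
    have sk: "s < k"
    proof (rule ccontr)
      assume "\<not> s < k"
      with wk have "k < s" by (cases "k = s") auto
      with K_antimono[OF k(1), of s] s S_subset_K wk show False by fastforce
    qed
    \<comment> \<open>Otherwise the successor of \<open>s\<close> in \<open>S\<close> would be at
      most \<open>k\<close>, hence before \<open>y\<close>.\<close>
    have kS: "k \<notin> S"
    proof
      assume kS: "k \<in> S"
      then have "s \<noteq> Max S" using Max_ge[OF finite_S kS] sk by linarith
      then have "\<sigma> s \<le> k" using \<sigma>_next(3)[OF s _ kS sk] by simp
      moreover have "\<sigma> s \<noteq> y" using \<sigma>_next(1)[OF s \<open>s \<noteq> Max S\<close>] y by blast
      ultimately show False using before k(2) \<open>s \<noteq> Max S\<close> by auto
    qed
    obtain t where t: "t \<in> S" "t < k" "r k < r t" using S_skip[OF k(1) kS] .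
    have "t \<le> s"
    proof (rule ccontr)
      assume "\<not> t \<le> s"
      then have st: "s < t" by simp
      then have "s \<noteq> Max S" using Max_ge[OF finite_S t(1)] by linarith
      then have "\<sigma> s \<le> t" using \<sigma>_next(3)[OF s _ t(1) st] by simp
      with before \<open>s \<noteq> Max S\<close> t k show False by auto
    qed
    have "r y \<le> r k" using k y by (intro r_le_of_below) (auto simp: K_iff)
    also note t(3)
    also have "r t \<le> r (\<tau> s)"
      using \<tau>_S[OF s] t \<open>t \<le> s\<close> by (intro S_mono) auto
    finally show ?thesis .
  qed
qed

text \<open>Checks the two characterizing properties of the code of \<open>u\<close> for the
  pulled-back entries, by cases on membership in \<open>S\<close>.\<close>

lemma rajcode_u:
  assumes "x \<in> {1..n}"
  shows "rajcode n u x = r (\<tau> x)"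
proof (rule rajcode_unique[OF _ _ assms])
  fix x y assume x: "x \<in> {1..n}" and y: "y \<in> {1..n}" and xy: "x < y" "u x < u y"
  \<comment> \<open>Before \<open>a\<close> nothing has changed, and \<open>w\<close> exceeds all
    later values there, so no increasing pair starts before \<open>a\<close>.\<close>
  have "a \<le> x"
  proof (rule ccontr)
    assume "\<not> a \<le> x"
    then have xa: "x < a" by simp
    then have ux: "u x = w x" using S_gt_a by (intro u_outside) fastforce+
    have "x < \<sigma> y"
    proof -
      consider "y = a" | "y = Max S" | "y \<in> S" "y \<noteq> Max S" | "y \<noteq> a" "y \<notin> S" by blast
      then show ?thesis
        using xy xa less_trans[OF xa S_gt_a[OF Min_S_mem]] \<sigma>_next(2)[of y]
        by cases (auto simp: \<sigma>_def shift_start shift_Max shift_outside)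
    qed
    moreover have "\<sigma> y \<in> {1..n}" using permutes_in_image[OF \<sigma>_permutes] y by blast
    ultimately have "u y < u x" unfolding ux using w_less_before_a[OF x _ xa] by (simp add: u_eq)
    with xy show False by simp
  qed
  then consider "x = a" | "a < x" "x \<notin> S" "y \<notin> S" | "a < x" "x \<notin> S" "y \<in> S"
    | "x \<in> S" "y \<notin> S" | "x \<in> S" "y \<in> S"
    by fastforce
  then show "r (\<tau> y) < r (\<tau> x)"
  proof cases
    case 1
    with u_greater_u_a[OF y] xy have "y \<notin> S" "Min S < y" by auto
    then show ?thesis
      using 1 xy y S_mem[of "Min S"] u_a u_outside[of y]
      by (auto simp: \<tau>_a \<tau>_outside intro!: rajcode_less)
  next
    case 2
    with xy x y show ?thesis
      by (auto simp: \<tau>_outside u_outside intro!: rajcode_less)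
  next
    case 3
    \<comment> \<open>The gap below the cover position \<open>y\<close> forces \<open>w x\<close>
      under \<open>w a\<close>, hence under every value of \<open>w\<close> on \<open>S\<close>, in
      particular the one at \<open>\<tau> y\<close>.\<close>
    then have "w x < w y" using xy u_S_less[of y] u_outside[of x] by simp
    then have "w x < w a" using K_gap[of y x] 3 xy S_subset_K by blast
    then have "w x < w (\<tau> y)" using S_w_gt[of "\<tau> y"] \<tau>_S(1)[of y] 3 by simp
    moreover have "x < \<tau> y" using xy \<tau>_S(2)[of y] 3 by simp
    ultimately show ?thesis
      using 3 x S_mem \<tau>_S(1)[of y] by (auto simp: \<tau>_outside intro!: rajcode_less)
  next
    case 4
    then have "a < y" using S_gt_a xy by fastforce
    with 4 xy y show ?thesis
      using r_less_\<tau>[of x y] by (simp add: \<tau>_outside u_outside)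
  next
    case 5
    with u_S_antimono[of x y] xy show ?thesis by simp
  qed
next
  fix x assume x: "x \<in> {1..n}" and nz: "r (\<tau> x) \<noteq> 0"
  have "a \<le> x"
  proof (rule ccontr)
    assume "\<not> a \<le> x"
    then have "x < a" by simp
    moreover from this have "\<tau> x = x" using S_gt_a by (intro \<tau>_outside) fastforce+
    ultimately show False
      using rajcode_step[OF x, of w] nz w_less_before_a[OF x] by (metis not_less_iff_gr_or_eq)
  qed
  then consider "x = a" | "x \<in> S" | "a < x" "x \<notin> S" by fastforce
  then show "\<exists>y\<in>{1..n}. x < y \<and> u x < u y \<and> r (\<tau> x) \<le> Suc (r (\<tau> y))"
  proof cases
    case 3
    then obtain m where m: "m \<in> {1..n}" "x < m" "w x < w m" "r x \<le> Suc (r m)"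
      using rajcode_step[OF x] nz by (metis \<tau>_outside less_irrefl)
    have eqs: "\<tau> x = x" "u x = w x" using 3 by (auto simp: \<tau>_outside u_outside)
    show ?thesis
    \<comment> \<open>The witness for \<open>w\<close> still works for \<open>u\<close>: if its
      value drops, it drops no lower than \<open>w a\<close>, which remains above
      \<open>w x\<close>.\<close>
    proof (cases "m \<in> S")
      case True
      have "w x < w a" using K_gap[of m x] True S_subset_K 3 m by blast
      then have "u x < u m" using u_S_ge[OF True] eqs by simp
      moreover have "r m \<le> r (\<tau> m)" using \<tau>_S[OF True] True by (intro S_mono)
      ultimately show ?thesis using m eqs by (intro bexI[of _ m]) auto
    next
      case False
      then show ?thesis
        using m 3 eqs by (intro bexI[of _ m]) (auto simp: \<tau>_outside u_outside)
    qed
  next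
    case 1
    then have "r (Min S) \<noteq> 0" using nz \<tau>_a by simp
    then obtain m where m: "m \<in> {1..n}" "Min S < m" "w (Min S) < w m" "r (Min S) \<le> Suc (r m)"
      using rajcode_step[OF S_mem[OF Min_S_mem]] by blast
    have "a < m" using S_gt_a[OF Min_S_mem] m(2) by (rule less_trans)
    moreover have "m \<notin> S" using w_le_w_Min[of m] m by auto
    ultimately show ?thesis
      using m 1 by (intro bexI[of _ m]) (auto simp: \<tau>_a \<tau>_outside u_a u_outside)
  next
    case 2
    \<comment> \<open>The witness is taken from position \<open>\<tau> x\<close>, which lies weakly
      to the right of \<open>x\<close> and whose value under \<open>w\<close> is at least
      \<open>u x\<close>.\<close>
    obtain m where m: "m \<in> {1..n}" "\<tau> x < m" "w (\<tau> x) < w m" "r (\<tau> x) \<le> Suc (r m)"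
      using rajcode_step[OF S_mem[OF \<tau>_S(1)[OF 2]] nz] by blast
    have "x < m" using \<tau>_S(2)[OF 2] m by simp
    moreover from this have "a < m" using S_gt_a[OF 2] by simp
    moreover have "m \<notin> S" using S_antimono[OF \<tau>_S(1)[OF 2], of m] m by auto
    ultimately show ?thesis
      using m \<tau>_S(3)[OF 2] by (intro bexI[of _ m]) (auto simp: \<tau>_outside u_outside)
  qed
qed

text \<open>Reindex the sum along the permutation \<open>\<sigma>\<close>. It differs from the sum
  along \<open>\<tau>\<close> only at \<open>Max S\<close>, where \<open>r a\<close> exceeds
  \<open>r (Max S)\<close> by one.\<close>

lemma raj_u: "raj n w = Suc (raj n u)"
proof -
  have M: "Max S \<in> {1..n}" using S_mem Max_S_mem by blast
  have "raj n w = (\<Sum>x=1..n. r (\<sigma> x))"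
    unfolding raj_def using sum.permute[OF \<sigma>_permutes, of r] by (simp add: comp_def)
  also have "\<dots> = r (\<sigma> (Max S)) + (\<Sum>x\<in>{1..n} - {Max S}. r (\<sigma> x))"
    using sum.remove[OF _ M] by simp
  also have "r (\<sigma> (Max S)) = Suc (r (\<tau> (Max S)))"
    by (simp add: \<sigma>_def \<tau>_def shift_Max r_a)
  also have "(\<Sum>x\<in>{1..n} - {Max S}. r (\<sigma> x)) = (\<Sum>x\<in>{1..n} - {Max S}. r (\<tau> x))"
    by (intro sum.cong) (auto simp: \<tau>_def)
  also have "Suc (r (\<tau> (Max S))) + (\<Sum>x\<in>{1..n} - {Max S}. r (\<tau> x)) = Suc (\<Sum>x=1..n. r (\<tau> x))"
    using sum.remove[OF _ M, of "\<lambda>x. r (\<tau> x)"] by simp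
  also have "(\<Sum>x=1..n. r (\<tau> x)) = raj n u"
    unfolding raj_def by (intro sum.cong) (simp_all add: rajcode_u)
  finally show ?thesis .
qed

section \<open>Covers and markings of the staircase\<close>

text \<open>Before the link \<open>(a, c)\<close>, positions after \<open>a\<close> up to
  \<open>c\<close> are untouched, and the value at \<open>a\<close> has risen to at most that of a
  later cover position, which is still below \<open>w c\<close>. The gap condition for
  \<open>c\<close> in \<open>w\<close> therefore persists.\<close>

lemma covering_chain_descending:
  assumes "sorted_wrt (>) bs" "set bs \<subseteq> K"
  shows "covering_chain n w (map (Pair a) bs)"
  using assms
proof (induction bs rule: rev_induct)
  case (snoc c bs)
  let ?v = "apply_links w (map (Pair a) bs)"
  have c: "c \<in> K" and sorted: "sorted_wrt (>) bs" and bsK: "set bs \<subseteq> K"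
    and less: "\<And>b. b \<in> set bs \<Longrightarrow> c < b"
    using snoc.prems by (auto simp: sorted_wrt_append)
  have v: "?v permutes {1..n}"
    using perm a_mem bsK by (intro apply_links_permutes) (auto simp: K_iff)
  have ac: "a < c" using c by (simp add: K_iff)
  have v_before: "?v m = w m" if "a < m" "m \<le> c" for m
  proof (cases "bs = []")
    case False
    have "m \<notin> set bs" using less that by fastforce
    with that False sorted bsK show ?thesis
      by (subst apply_links_descending) (auto simp: K_iff shift_outside)
  qed simp
  have v_a: "w a \<le> ?v a \<and> ?v a < w c"
  proof (cases "bs = []")
    case False
    then have eq: "?v a = w (Min (set bs))"
      using sorted bsK by (subst apply_links_descending) (auto simp: K_iff shift_start)
    have "Min (set bs) \<in> set bs" using False by simp
    then have "Min (set bs) \<in> K" "c < Min (set bs)" using bsK less by auto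
    then show ?thesis unfolding eq using K_antimono[OF c] by (auto simp: K_iff)
  qed (use c in \<open>simp add: K_iff\<close>)
  have "\<not> (?v a < ?v m \<and> ?v m < ?v c)" if "a < m" "m < c" for m
    using v_before[of m] v_before[of c] v_a K_gap[OF c that] that by auto
  then have "bruhat_cover n ?v (?v \<circ> transpose a c)"
    using v_before[of c] v_a ac c
    by (subst bruhat_cover_transpose_iff[OF v a_mem]) (auto simp: K_iff)
  with snoc.IH[OF sorted bsK] show ?case by simp
qed simp

lemma covering_chain_stair: "covering_chain n w (stair n w)"
  unfolding stair_eq using covering_chain_descending[OF descending_S] S_subset_K by simp

text \<open>Only the first link of the staircase is marked. The assumption makes the first link of
  \<open>C\<close> marked both after \<open>(a, Min S)\<close> and at the start of a chain, and it
  prevents the marked staircase link from occurring again in \<open>C\<close>.\<close>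

lemma marked_after_stair:
  assumes C: "\<And>i j. (i, j) \<in> set C \<Longrightarrow> a < i \<or> i = a \<and> Min S < j \<and> j \<notin> S"
  shows "card (marked_after (0, 0) (stair n w @ C)) = Suc (card (marked_after (0, 0) C))"
proof -
  obtain b bs where bs: "rev (sorted_list_of_set S) = b # bs"
    by (cases "rev (sorted_list_of_set S)") auto
  have set_bs: "insert b (set bs) = S"
    using arg_cong[OF bs, of set] by simp
  have "last (b # bs) = Min S"
    using sorted_list_of_set_nonempty[OF finite_S S_nonempty] arg_cong[OF bs, of last]
    by (simp add: last_rev)
  moreover have "sorted_wrt (>) (b # bs)" using descending_S bs by simp
  ultimately have "marked_after (a, b) (map (Pair a) bs @ C) = marked_after (a, Min S) C"
    using marked_after_descending[of b bs a C] by simp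
  also have "\<dots> = marked_after (0, 0) C"
    using C a_mem by (cases C) (fastforce simp: ascends_def)+
  finally have "marked_after (0, 0) (stair n w @ C) = insert (a, b) (marked_after (0, 0) C)"
    using a_mem by (simp add: stair_eq bs ascends_def)
  moreover have "(a, b) \<notin> marked_after (0, 0) C"
    using C[of a b] marked_after_subset set_bs by blast
  moreover have "finite (marked_after (0, 0) C)"
    using finite_subset[OF marked_after_subset] by blast
  ultimately show ?thesis by simp
qed

lemma first_defect_u_ge:
  assumes "u \<noteq> w0 n"
  shows "a \<le> first_defect n u"
proof -
  interpret v: staircase_step n u
    using u_permutes assms by unfold_locales
  have "v.a \<noteq> k" if "k \<in> {1..n}" "k < a" for k
    using v.w_a_neq w_before_a[OF that] u_outside[of k] S_gt_a[of k] that by auto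
  from this[of v.a] v.a_mem show ?thesis by (auto simp: v.a_def not_less[symmetric])
qed

end

section \<open>Induction over the staircases\<close>

text \<open>Termination and correctness share one induction on \<open>raj\<close>, which each
  staircase lowers. The clause \<open>w i < w j\<close> for links at the first defect is what the
  preceding staircase needs to count its markings; \<open>w \<noteq> w0 n\<close> is carried along
  because \<open>first_defect\<close> is the minimum of an empty set at \<open>w0 n\<close>.\<close>

lemma staircase_chain_properties:
  assumes "w permutes {1..n}"
  shows "staircase_chain_dom (n, w) \<and>
    (\<forall>(i, j)\<in>set (staircase_chain n w). w \<noteq> w0 n \<and> first_defect n w \<le> i \<and> i \<in> {1..n} \<and>
       j \<in> {1..n} \<and> i < j \<and> (i = first_defect n w \<longrightarrow> w i < w j)) \<and>
    sorted (map fst (staircase_chain n w)) \<and>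
    apply_links w (staircase_chain n w) = w0 n \<and>
    covering_chain n w (staircase_chain n w) \<and>
    card (marked_after (0, 0) (staircase_chain n w)) = raj n w"
  using assms
proof (induction "raj n w" arbitrary: w rule: less_induct)
  case less
  show ?case
  proof (cases "w = w0 n")
    case True
    have dom: "staircase_chain_dom (n, w)"
      by (rule staircase_chain.domintros) (simp add: True)
    then have "staircase_chain n w = []" using True by (simp add: staircase_chain.psimps)
    with dom True show ?thesis by (simp add: raj_w0)
  next
    case False
    interpret staircase_step n w
      using less.prems False by unfold_locales
    let ?C = "staircase_chain n u"
    have IH: "staircase_chain_dom (n, u)"
      "\<And>i j. (i, j) \<in> set ?C \<Longrightarrow> u \<noteq> w0 n \<and> first_defect n u \<le> i \<and> i \<in> {1..n} \<and>
         j \<in> {1..n} \<and> i < j \<and> (i = first_defect n u \<longrightarrow> u i < u j)"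
      "sorted (map fst ?C)" "apply_links u ?C = w0 n" "covering_chain n u ?C"
      "card (marked_after (0, 0) ?C) = raj n u"
      using less.hyps[OF _ u_permutes] raj_u by auto
    have dom: "staircase_chain_dom (n, w)"
      by (rule staircase_chain.domintros) (use IH(1) in \<open>simp add: u_def\<close>)
    then have eq: "staircase_chain n w = stair n w @ ?C"
      using False by (simp add: staircase_chain.psimps u_def)
    \<comment> \<open>If \<open>i = a\<close>, the first defect of \<open>u\<close> is squeezed to
      \<open>a\<close>, so the induction hypothesis yields \<open>u a < u j\<close>.\<close>
    have C: "a \<le> i \<and> i \<in> {1..n} \<and> j \<in> {1..n} \<and> i < j \<and> (i = a \<longrightarrow> u a < u j)"
      if "(i, j) \<in> set ?C" for i j
      using IH(2)[OF that] first_defect_u_ge by auto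
    have C_a: "j \<notin> S \<and> w a < w j \<and> Min S < j" if "(a, j) \<in> set ?C" for j
      using u_greater_u_a[of j] C[OF that] by blast
    have stair: "i = a \<and> j \<in> {1..n} \<and> a < j \<and> w a < w j" if "(i, j) \<in> set (stair n w)" for i j
      using that S_mem S_gt_a S_w_gt by (auto simp: stair_eq)
    have links: "case l of (i, j) \<Rightarrow> w \<noteq> w0 n \<and> first_defect n w \<le> i \<and> i \<in> {1..n} \<and>
       j \<in> {1..n} \<and> i < j \<and> (i = first_defect n w \<longrightarrow> w i < w j)"
      if "l \<in> set (staircase_chain n w)" for l
    proof (cases l)
      case (Pair i j)
      with that consider "(i, j) \<in> set (stair n w)" | "(i, j) \<in> set ?C"
        by (auto simp: eq)
      then show ?thesis
      proof cases
        case 1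
        from stair[OF this] show ?thesis using False a_mem by (simp add: Pair a_def[symmetric])
      next
        case 2
        from C[OF 2] C_a[of j] 2 show ?thesis using False by (auto simp: Pair a_def[symmetric])
      qed
    qed
    have markings: "card (marked_after (0, 0) (staircase_chain n w)) = raj n w"
      unfolding eq raj_u IH(6)[symmetric]
      by (rule marked_after_stair) (metis C C_a le_neq_implies_less)
    have "map fst (stair n w) = replicate (card S) a"
      by (simp add: stair_eq comp_def map_replicate_const)
    moreover have "a \<le> i" if "i \<in> set (map fst ?C)" for i
      using that C by fastforce
    ultimately have sorted: "sorted (map fst (staircase_chain n w))"
      using IH(3) by (simp add: eq sorted_append del: set_map)
    have covers: "covering_chain n w (staircase_chain n w)"
      and last: "apply_links w (staircase_chain n w) = w0 n"
      unfolding eq using IH(4,5) covering_chain_stair by (simp_all add: u_def)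
    show ?thesis
      by (intro conjI ballI dom links sorted last covers markings)
  qed
qed

theorem theorem11p12:
  fixes n :: nat and w :: "nat \<Rightarrow> nat"
  assumes "w permutes {1..n}"
  shows "heavy_climbing_chain n w (staircase_chain n w)"
  using staircase_chain_properties[OF assms]
  unfolding heavy_climbing_chain_def climbing_chain_def minimal_markings_eq covering_chain_iff
  by auto

end
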